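(* Let $a,b,c,d,e$ be nonzero integers, and let $f(x)=x+a+\frac{b}{x}$ and $g(y)=y^2+cy+d+\frac{e}{y}$. Then the Diophantine equation $z^2=f(x)^2+g(y)^2$ or the Diophantine equation $z^2=f(x)^2-g(y)^2$ has infinitely many nontrivial rational parametric solutions $(x,y,z)$.
   Context: A solution $(x,y,z)$ of $z^2=f(x)^2\pm g(y)^2$ is called nontrivial if $f(x)g(y)\neq 0$ and $f(x)^2\neq g(y)^2$. A rational parametric solution is a solution $(x,y,z)$ whose coordinates are rational functions (with rational coefficients) of a parameter, i.e. a solution over the field $\mathbb{Q}(T)$ of rational functions in an indeterminate $T$. *)

theory Defs
  imports "HOL-Computational_Algebra.Fraction_Field" "HOL-Computational_Algebra.Polynomial"
begin

text \<open>The field \<open>\<rat>(T)\<close> of rational functions in one indeterminate, as the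
  fraction field of \<open>\<rat>[T]\<close>.\<close>

type_synonym ratfun = "rat poly fract"

definition f_fun :: "int \<Rightarrow> int \<Rightarrow> 'k::field \<Rightarrow> 'k" where
  "f_fun a b x = x + of_int a + of_int b / x"

definition g_fun :: "int \<Rightarrow> int \<Rightarrow> int \<Rightarrow> 'k::field \<Rightarrow> 'k" where
  "g_fun c d e y = y ^ 2 + of_int c * y + of_int d + of_int e / y"

text \<open>Division by zero yields zero in HOL, so solutions are explicitly required to lie in
  the domains of \<open>f\<close> and \<open>g\<close>, i.e. \<open>x \<noteq> 0\<close> and \<open>y \<noteq> 0\<close>.\<close>

definition is_solution_plus ::
  "int \<Rightarrow> int \<Rightarrow> int \<Rightarrow> int \<Rightarrow> int \<Rightarrow> 'k::field \<times> 'k \<times> 'k \<Rightarrow> bool" where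
  "is_solution_plus a b c d e = (\<lambda>(x, y, z).
     x \<noteq> 0 \<and> y \<noteq> 0 \<and> z ^ 2 = f_fun a b x ^ 2 + g_fun c d e y ^ 2)"

definition is_solution_minus ::
  "int \<Rightarrow> int \<Rightarrow> int \<Rightarrow> int \<Rightarrow> int \<Rightarrow> 'k::field \<times> 'k \<times> 'k \<Rightarrow> bool" where
  "is_solution_minus a b c d e = (\<lambda>(x, y, z).
     x \<noteq> 0 \<and> y \<noteq> 0 \<and> z ^ 2 = f_fun a b x ^ 2 - g_fun c d e y ^ 2)"

definition nontrivial ::
  "int \<Rightarrow> int \<Rightarrow> int \<Rightarrow> int \<Rightarrow> int \<Rightarrow> 'k::field \<times> 'k \<times> 'k \<Rightarrow> bool" where
  "nontrivial a b c d e = (\<lambda>(x, y, z).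
     f_fun a b x * g_fun c d e y \<noteq> 0 \<and> f_fun a b x ^ 2 \<noteq> g_fun c d e y ^ 2)"

end

theory Submission
  imports Defs
begin

text \<open>
  The equation \<open>z\<^sup>2 = f(x)\<^sup>2 + g(y)\<^sup>2\<close> always suffices. Put \<open>G = g(y)\<close>. The choice
  \<open>f(x) = G (t\<^sup>2 - 1) / (2 t)\<close> makes \<open>f(x)\<^sup>2 + G\<^sup>2\<close> a square, and it can be solved for \<open>x\<close> iff
  \<open>(G t\<^sup>2 - 2 a t - G)\<^sup>2 - 16 b t\<^sup>2\<close> is a square. The parabola \<open>w = G t\<^sup>2 - 2 a t + G\<close> meets the
  resulting genus one curve \<open>w\<^sup>2 = (G t\<^sup>2 - 2 a t - G)\<^sup>2 - 16 b t\<^sup>2\<close> in just one further point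
  besides those with \<open>t = 0\<close> and \<open>t = \<infinity>\<close>, namely at \<open>t = 2 a G / (G\<^sup>2 + 4 b)\<close>, and there
  \<open>x = - (G\<^sup>2 + 4 b) / (4 a)\<close>. All but finitely many \<open>y\<close> give a nontrivial solution, so one may
  take \<open>y = T + n\<close> for almost all natural numbers \<open>n\<close>.
\<close>

definition x_sol :: "int \<Rightarrow> int \<Rightarrow> 'k::field \<Rightarrow> 'k" where
  "x_sol a b G = - (G\<^sup>2 + 4 * of_int b) / (4 * of_int a)"

text \<open>This is \<open>G * (t^2 + 1) / (2 * t)\<close> at
  \<open>t = 2 * a * G / (G^2 + 4 * b)\<close>, with \<open>G\<close> cancelled.\<close>

definition z_sol :: "int \<Rightarrow> int \<Rightarrow> 'k::field \<Rightarrow> 'k" where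
  "z_sol a b G = ((2 * of_int a * G)\<^sup>2 + (G\<^sup>2 + 4 * of_int b)\<^sup>2)
     / (4 * of_int a * (G\<^sup>2 + 4 * of_int b))"

lemma f_fun_x_sol:
  fixes G :: "'k::field"
  assumes "4 * of_int a \<noteq> (0::'k)" and "G\<^sup>2 + 4 * of_int b \<noteq> 0"
  shows "f_fun a b (x_sol a b G) = ((2 * of_int a * G)\<^sup>2 - (G\<^sup>2 + 4 * of_int b)\<^sup>2)
           / (4 * of_int a * (G\<^sup>2 + 4 * of_int b))"
proof -
  define A B Q :: 'k where "A = 4 * of_int a" and "B = of_int b" and "Q = G\<^sup>2 + 4 * of_int b"
  have nz: "A \<noteq> 0" "Q \<noteq> 0"
    using assms by (simp_all add: A_def Q_def)
  have "f_fun a b (x_sol a b G) = - Q / A + of_int a + B / (- Q / A)"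
    by (simp add: f_fun_def x_sol_def A_def B_def Q_def)
  also have "\<dots> = (of_int a * A * Q - Q\<^sup>2 - A\<^sup>2 * B) / (A * Q)"
    using nz by (simp add: field_simps power2_eq_square)
  \<comment> \<open>Since \<open>Q - 4 * b = G^2\<close>, the outer terms combine to
    \<open>4 * a^2 * (Q - 4 * b) = (2 * a * G)^2\<close>.\<close>
  also have "of_int a * A * Q - Q\<^sup>2 - A\<^sup>2 * B = (2 * of_int a * G)\<^sup>2 - Q\<^sup>2"
    by (simp add: A_def B_def Q_def algebra_simps power2_eq_square)
  finally show ?thesis
    by (simp add: A_def Q_def)
qed

text \<open>Here \<open>t = P / Q\<close>. Multiplied by \<open>4 * a * Q\<close>, the values of
  \<open>f\<close>, \<open>g\<close> and \<open>z\<close> become the Pythagorean triple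
  \<open>P^2 - Q^2\<close>, \<open>2 * P * Q\<close>, \<open>P^2 + Q^2\<close>. The three conditions
  \<open>PQ\<close> exclude \<open>f = 0\<close>, \<open>f = g\<close> and
  \<open>f = -g\<close>.\<close>

lemma solution_plus_of_y:
  fixes a b c d e :: int and y :: "'k::field"
  defines "G \<equiv> g_fun c d e y"
  defines "P \<equiv> 2 * of_int a * G" and "Q \<equiv> G\<^sup>2 + 4 * of_int b"
  assumes a: "4 * of_int a \<noteq> (0::'k)" and y: "y \<noteq> 0" and G: "G \<noteq> 0" and Q: "Q \<noteq> 0"
    and PQ: "P\<^sup>2 - Q\<^sup>2 \<noteq> 0" "P\<^sup>2 - Q\<^sup>2 - 2 * P * Q \<noteq> 0" "P\<^sup>2 - Q\<^sup>2 + 2 * P * Q \<noteq> 0"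
  shows "is_solution_plus a b c d e (x_sol a b G, y, z_sol a b G)"
    and "nontrivial a b c d e (x_sol a b G, y, z_sol a b G)"
proof -
  define N where "N = 4 * of_int a * Q"
  have N: "N \<noteq> 0"
    using a Q by (simp add: N_def)
  have f: "f_fun a b (x_sol a b G) = (P\<^sup>2 - Q\<^sup>2) / N"
    using f_fun_x_sol a Q unfolding N_def P_def Q_def by blast
  have g: "G = 2 * P * Q / N"
    using N by (simp add: eq_divide_eq) (simp add: N_def P_def)
  have z: "z_sol a b G = (P\<^sup>2 + Q\<^sup>2) / N"
    by (simp add: z_sol_def N_def P_def Q_def)
  have "(P\<^sup>2 + Q\<^sup>2)\<^sup>2 = (P\<^sup>2 - Q\<^sup>2)\<^sup>2 + (2 * P * Q)\<^sup>2"
    by algebra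
  then have "((P\<^sup>2 + Q\<^sup>2) / N)\<^sup>2 = ((P\<^sup>2 - Q\<^sup>2) / N)\<^sup>2 + (2 * P * Q / N)\<^sup>2"
    by (simp only: power_divide flip: add_divide_distrib)
  then have "(z_sol a b G)\<^sup>2 = (f_fun a b (x_sol a b G))\<^sup>2 + G\<^sup>2"
    by (simp only: f z flip: g)
  moreover have "x_sol a b G \<noteq> 0"
    using a Q unfolding x_sol_def Q_def divide_eq_0_iff neg_equal_0_iff_equal by blast
  ultimately show "is_solution_plus a b c d e (x_sol a b G, y, z_sol a b G)"
    using y by (simp add: is_solution_plus_def G_def)
  have "(P\<^sup>2 - Q\<^sup>2)\<^sup>2 - (2 * P * Q)\<^sup>2 = (P\<^sup>2 - Q\<^sup>2 - 2 * P * Q) * (P\<^sup>2 - Q\<^sup>2 + 2 * P * Q)"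
    by algebra
  then have "(P\<^sup>2 - Q\<^sup>2)\<^sup>2 \<noteq> (2 * P * Q)\<^sup>2"
    using PQ(2,3) by auto
  then have "((P\<^sup>2 - Q\<^sup>2) / N)\<^sup>2 \<noteq> (2 * P * Q / N)\<^sup>2"
    using N by (simp add: power_divide)
  then have "(f_fun a b (x_sol a b G))\<^sup>2 \<noteq> G\<^sup>2"
    by (simp only: f flip: g) simp
  moreover have "f_fun a b (x_sol a b G) \<noteq> 0"
    using f PQ(1) N by simp
  ultimately show "nontrivial a b c d e (x_sol a b G, y, z_sol a b G)"
    using G by (simp add: nontrivial_def G_def)
qed

text \<open>Clearing the denominator turns the condition into a monic cubic equation in
  \<open>y\<close>.\<close>

lemma finite_g_fun_fibre: "finite {y::'k::field. y \<noteq> 0 \<and> g_fun c d e y = G}"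
proof (rule finite_subset)
  let ?p = "[:of_int e, of_int d - G, of_int c, 1:] :: 'k poly"
  show "finite {y. poly ?p y = 0}"
    by (rule poly_roots_finite) simp
  show "{y. y \<noteq> 0 \<and> g_fun c d e y = G} \<subseteq> {y. poly ?p y = 0}"
    by (auto simp: g_fun_def field_simps power2_eq_square)
qed

lemma finite_degenerate_values:
  fixes A B :: "'k::field"
  defines "P \<equiv> \<lambda>G. 2 * A * G" and "Q \<equiv> \<lambda>G. G\<^sup>2 + 4 * B"
  shows "finite {G. G = 0 \<or> Q G = 0 \<or> (P G)\<^sup>2 - (Q G)\<^sup>2 = 0
           \<or> (P G)\<^sup>2 - (Q G)\<^sup>2 - 2 * P G * Q G = 0 \<or> (P G)\<^sup>2 - (Q G)\<^sup>2 + 2 * P G * Q G = 0}"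
proof -
  define p q where "p = [:0, 2 * A:]" and "q = [:4 * B, 0, 1:]"
  have pq: "poly p = P" "poly q = Q"
    by (auto simp: p_def q_def P_def Q_def algebra_simps power2_eq_square)
  have fin: "finite {G. (P G)\<^sup>2 - (Q G)\<^sup>2 + k * P G * Q G = 0}" for k
  proof -
    let ?r = "p\<^sup>2 - q\<^sup>2 + smult k (p * q)"
    \<comment> \<open>Only \<open>q^2\<close> reaches degree 4, so the leading term is independent
      of \<open>k\<close>, \<open>A\<close> and \<open>B\<close>.\<close>
    have "coeff ?r 4 = - 1"
      by (simp add: p_def q_def power2_eq_square numeral_eq_Suc)
    then have "?r \<noteq> 0"
      by force
    then show ?thesis
      using poly_roots_finite[of ?r] by (simp add: pq mult.assoc)
  qed
  have "q \<noteq> 0"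
    by (simp add: q_def)
  then have "finite {G. Q G = 0}"
    using poly_roots_finite[of q] by (simp add: pq)
  then show ?thesis
    using fin[of 0] fin[of "- 2"] fin[of 2] by (simp add: Collect_disj_eq)
qed

text \<open>Prescribing the set \<open>Y\<close> makes it possible to choose non-constant
  \<open>y\<close>, so that the solutions really depend on the parameter.\<close>

lemma infinite_solutions_plus:
  fixes Y :: "'k::field set"
  assumes a: "4 * of_int a \<noteq> (0::'k)" and Y: "infinite Y"
  shows "infinite {(x, y, z). y \<in> Y \<and> is_solution_plus a b c d e (x, y, z)
           \<and> nontrivial a b c d e (x, y, z)}" (is "infinite ?S")
proof
  let ?P = "\<lambda>G. 2 * of_int a * G :: 'k" and ?Q = "\<lambda>G. G\<^sup>2 + 4 * of_int b :: 'k"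
  define D where "D = {G. G = 0 \<or> ?Q G = 0 \<or> (?P G)\<^sup>2 - (?Q G)\<^sup>2 = 0
    \<or> (?P G)\<^sup>2 - (?Q G)\<^sup>2 - 2 * ?P G * ?Q G = 0 \<or> (?P G)\<^sup>2 - (?Q G)\<^sup>2 + 2 * ?P G * ?Q G = 0}"
  define E where "E = insert 0 (\<Union>G\<in>D. {y::'k. y \<noteq> 0 \<and> g_fun c d e y = G})"
  have "finite D"
    unfolding D_def by (rule finite_degenerate_values)
  then have "finite E"
    by (simp add: E_def finite_g_fun_fibre)
  \<comment> \<open>Distinct \<open>y\<close> give distinct triples, so projecting to the second
    coordinate suffices.\<close>
  have "Y - E \<subseteq> (\<lambda>(x, y, z). y) ` ?S"
  proof
    fix y assume y: "y \<in> Y - E"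
    let ?G = "g_fun c d e y"
    have "y \<noteq> 0" "?G \<notin> D"
      using y by (auto simp: E_def)
    then have "(x_sol a b ?G, y, z_sol a b ?G) \<in> ?S"
      using y a solution_plus_of_y[of a y c d e b] by (simp add: D_def)
    then show "y \<in> (\<lambda>(x, y, z). y) ` ?S"
      by force
  qed
  moreover assume "finite ?S"
  ultimately have "finite (Y - E)"
    using finite_surj by blast
  then show False
    using Y \<open>finite E\<close> by simp
qed

text \<open>This reduces \<open>4 * a \<noteq> 0\<close> in the function field to a comparison of
  constant polynomials.\<close>

lemma of_int_fract_poly: "(of_int n :: ratfun) = Fraction_Field.Fract [:of_int n:] 1"
proof -
  have *: "(of_nat m :: ratfun) = Fraction_Field.Fract [:of_nat m:] 1" for m
    by (induction m) (simp_all add: Zero_fract_def One_fract_def one_pCons)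
  show ?thesis
    by (cases n) (simp_all add: * del: of_nat_Suc)
qed

theorem theorem1p1:
  fixes a b c d e :: int
  assumes "a \<noteq> 0" and "b \<noteq> 0" and "c \<noteq> 0" and "d \<noteq> 0" and "e \<noteq> 0"
  shows "infinite {s :: ratfun \<times> ratfun \<times> ratfun.
             is_solution_plus a b c d e s \<and> nontrivial a b c d e s}
       \<or> infinite {s :: ratfun \<times> ratfun \<times> ratfun.
             is_solution_minus a b c d e s \<and> nontrivial a b c d e s}"
proof (rule disjI1)
  have "(of_int (4 * a) :: ratfun) \<noteq> 0"
    using assms(1) unfolding of_int_fract_poly by (simp add: Zero_fract_def eq_fract)
  then have a: "4 * of_int a \<noteq> (0 :: ratfun)"
    by simp
  \<comment> \<open>The fraction is \<open>T + n\<close>.\<close>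
  have "inj (\<lambda>n::nat. Fraction_Field.Fract [:of_nat n, 1:] 1 :: ratfun)"
    by (rule injI) (simp add: eq_fract)
  then have "infinite (range (\<lambda>n::nat. Fraction_Field.Fract [:of_nat n, 1:] 1 :: ratfun))"
    using finite_imageD by blast
  from infinite_solutions_plus[OF a this]
  show "infinite {s :: ratfun \<times> ratfun \<times> ratfun.
          is_solution_plus a b c d e s \<and> nontrivial a b c d e s}"
    by (rule contrapos_nn) (erule finite_subset[rotated], auto)
qed

end
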